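(* Let $I,J\subseteq\mathbb R$ be open intervals and let $a:I\to\mathbb R$, $b:J\to\mathbb R$ be arbitrary continuous functions. Put $$\Xi(x):=\exp\left(-\int^x a(\xi)\,\mathrm d\xi\right)\ (x\in I),\qquad \gamma(t):=\int^t b(\tau)\,\mathrm d\tau\ (t\in J).$$ The general solution of the second-order equation $$\frac{\mathrm d^2x}{\mathrm dt^2}=a(x)\left(\frac{\mathrm dx}{\mathrm dt}\right)^2+b(t)\,\frac{\mathrm dx}{\mathrm dt}$$ and of its associated first-order system $$\frac{\mathrm dx}{\mathrm dt}=y,\qquad \frac{\mathrm dy}{\mathrm dt}=a(x)\,y^2+b(t)\,y\qquad (y\neq0)$$ is given by $$\int^x\Xi(\xi)\,\mathrm d\xi=-c_1\left(c_2+\int^t \mathrm e^{\gamma(\tau)}\,\mathrm d\tau\right),\qquad y(t)=\frac{\mathrm dx}{\mathrm dt}=-c_1\,\frac{\mathrm e^{\gamma(t)}}{\Xi(x)},$$ where $c_1$ and $c_2$ are the two constants of integration determined by the initial conditions. That is, for functions $x:J'\to I$ and $y:J'\to\mathbb R\setminus\{0\}$ on an open interval $J'\subseteq J$, the pair $(x(t),y(t))$ is a solution of the first-order system on $J'$ if and only if there are real constants $c_1,c_2$ such that $\int^{x(t)}\Xi(\xi)\,\mathrm d\xi=-c_1\bigl(c_2+\int^t\mathrm e^{\gamma(\tau)}\mathrm d\tau\bigr)$ and $y(t)=-c_1\mathrm e^{\gamma(t)}/\Xi(x(t))$ for all $t\in J'$.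
   Context: Indefinite integrals $\int^x(\cdot)\,\mathrm d\xi$ and $\int^t(\cdot)\,\mathrm d\tau$ denote antiderivatives of the integrand, chosen once and for all (the same choice wherever the same integral appears); thus $\Xi>0$ and $\Xi'=-a\,\Xi$, $\gamma'=b$. The variable $y$ is assumed nonzero throughout. *)

theory Defs
  imports "HOL-Analysis.Analysis"
begin

text \<open>
  An indefinite integral of \<open>f\<close> is any function \<open>F\<close> satisfying this predicate; a fixed choice of
  antiderivative is a fixed such \<open>F\<close>. It is only used on open sets, so the two-sided
  derivative is the right one.
\<close>

definition antiderivative_on :: "real set \<Rightarrow> (real \<Rightarrow> real) \<Rightarrow> (real \<Rightarrow> real) \<Rightarrow> bool" where
  "antiderivative_on S f F \<longleftrightarrow> (\<forall>s\<in>S. (F has_real_derivative f s) (at s))"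

text \<open>Here \<open>A\<close> plays the role of the chosen indefinite integral of \<open>a\<close>.\<close>

definition Xi :: "(real \<Rightarrow> real) \<Rightarrow> real \<Rightarrow> real" where
  "Xi A x = exp (- A x)"

definition solves_second_order ::
    "(real \<Rightarrow> real) \<Rightarrow> (real \<Rightarrow> real) \<Rightarrow> real set \<Rightarrow> (real \<Rightarrow> real) \<Rightarrow> bool" where
  "solves_second_order a b T x \<longleftrightarrow>
     (\<forall>t\<in>T. (x has_real_derivative deriv x t) (at t) \<and>
            (deriv x has_real_derivative a (x t) * (deriv x t)\<^sup>2 + b t * deriv x t) (at t))"

definition solves_system ::
    "(real \<Rightarrow> real) \<Rightarrow> (real \<Rightarrow> real) \<Rightarrow> real set \<Rightarrow> (real \<Rightarrow> real) \<Rightarrow> (real \<Rightarrow> real) \<Rightarrow> bool" where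
  "solves_system a b T x y \<longleftrightarrow>
     (\<forall>t\<in>T. (x has_real_derivative y t) (at t) \<and>
            (y has_real_derivative a (x t) * (y t)\<^sup>2 + b t * y t) (at t))"

end

theory Submission
  imports Defs
begin

text \<open>
  Along a solution with \<open>y \<noteq> 0\<close> the quantity \<open>y \<cdot> exp (- A x - \<gamma>)\<close> is a first integral; call it
  \<open>- c1\<close>. Then \<open>(F \<circ> x)' = Xi x \<cdot> y = - c1 \<cdot> exp \<gamma>\<close>, so \<open>F \<circ> x + c1 \<cdot> G\<close> is constant as well.
  Conversely \<open>F' > 0\<close>, so \<open>F\<close> has a differentiable left inverse, which turns the implicit formula
  into \<open>x' = y\<close>; the second equation then follows by differentiating the formula for \<open>y\<close>.
\<close>

lemma has_real_derivative_zero_interval_imp_constant: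
  fixes f :: "real \<Rightarrow> real"
  assumes "is_interval T"
    and "\<And>t. t \<in> T \<Longrightarrow> (f has_real_derivative 0) (at t)"
  obtains c where "\<And>t. t \<in> T \<Longrightarrow> f t = c"
proof -
  have "convex T"
    using assms(1) is_interval_convex by blast
  then have "\<exists>c. \<forall>t\<in>T. f t = c"
    using assms(2) has_field_derivative_zero_constant[of T f]
    by (blast intro: has_field_derivative_at_within)
  then show thesis
    using that by blast
qed

text \<open>Because \<open>S\<close> is an interval, the segment between two of its points stays in
  \<open>S\<close>, so the sign of the derivative is known along all of it. This supplies the
  injectivity behind the left inverse of \<open>F\<close>.\<close>

lemma strict_mono_on_positive_derivative:
  fixes f f' :: "real \<Rightarrow> real"
  assumes "is_interval S"
    and der: "\<And>s. s \<in> S \<Longrightarrow> (f has_real_derivative f' s) (at s)"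
    and pos: "\<And>s. s \<in> S \<Longrightarrow> 0 < f' s"
  shows "strict_mono_on S f"
proof (rule strict_mono_onI)
  fix u v assume "u \<in> S" "v \<in> S" "u < v"
  then have "s \<in> S" if "u \<le> s" "s \<le> v" for s
    using assms(1) that mem_is_interval_1_I by blast
  then show "f u < f v"
    using \<open>u < v\<close> der pos by (metis DERIV_pos_imp_increasing)
qed

text \<open>No continuity of \<open>x\<close> is assumed: it comes from that of the left inverse of \<open>F\<close>.\<close>

lemma has_real_derivative_implicit:
  fixes F f x h :: "real \<Rightarrow> real"
  assumes "open S" "is_interval S" "open T" "t \<in> T" "x \<in> T \<rightarrow> S"
    and der: "\<And>s. s \<in> S \<Longrightarrow> (F has_real_derivative f s) (at s)"
    and pos: "\<And>s. s \<in> S \<Longrightarrow> 0 < f s"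
    and eq: "\<And>r. r \<in> T \<Longrightarrow> F (x r) = h r"
    and h: "(h has_real_derivative h') (at t)"
  shows "(x has_real_derivative h' / f (x t)) (at t)"
proof -
  define g where "g = inv_into S F"
  have xt: "x t \<in> S"
    using assms(4,5) by blast
  have "inj_on F S"
    using strict_mono_on_imp_inj_on[OF strict_mono_on_positive_derivative[OF assms(2) der pos]] .
  then have g: "g (F s) = s" if "s \<in> S" for s
    using that by (simp add: g_def)
  have "continuous_on S F"
    using der by (meson DERIV_isCont continuous_at_imp_continuous_on)
  moreover have "f (x t) \<noteq> 0"
    using pos[OF xt] by simp
  \<comment> \<open>Inverse function theorem: \<open>F\<close> is continuous on the open set
    \<open>S\<close>, \<open>g\<close> is a left inverse there, and
    \<open>f (x t) \<noteq> 0\<close> makes the derivative at \<open>x t\<close> invertible.\<close>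
  ultimately have "(g has_real_derivative inverse (f (x t))) (at (F (x t)))"
    using der[OF xt] unfolding has_field_derivative_def
    by (intro has_derivative_inverse_strong[where f = F and g = g, OF assms(1) xt _ g])
      (assumption | simp add: fun_eq_iff)+
  then have "(g has_real_derivative inverse (f (x t))) (at (h t))"
    by (simp add: eq[OF assms(4)])
  then have "((\<lambda>r. g (h r)) has_real_derivative inverse (f (x t)) * h') (at t)"
    by (rule DERIV_chain2[OF _ h])
  \<comment> \<open>Applying \<open>g\<close> to the implicit equation gives
    \<open>x r = g (h r)\<close> throughout the open set \<open>T\<close>, so \<open>x\<close>
    inherits the derivative of the composite.\<close>
  then have "(x has_real_derivative inverse (f (x t)) * h') (at t)"
  proof (rule has_field_derivative_transform_within_open[OF _ assms(3,4)])
    fix r assume "r \<in> T"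
    then have "x r \<in> S"
      using assms(5) by blast
    then show "g (h r) = x r"
      using g eq[OF \<open>r \<in> T\<close>] by metis
  qed
  then show ?thesis
    by (simp add: divide_inverse mult.commute)
qed

lemma solves_system_imp_implicit:
  assumes T: "is_interval T" "T \<subseteq> J" and x: "x \<in> T \<rightarrow> I" and y: "y \<in> T \<rightarrow> - {0}"
    and A: "antiderivative_on I a A"
    and \<gamma>: "antiderivative_on J b \<gamma>"
    and F: "antiderivative_on I (Xi A) F"
    and G: "antiderivative_on J (\<lambda>\<tau>. exp (\<gamma> \<tau>)) G"
    and sol: "solves_system a b T x y"
  shows "\<exists>c1 c2. \<forall>t\<in>T. F (x t) = - c1 * (c2 + G t) \<and> y t = - c1 * (exp (\<gamma> t) / Xi A (x t))"
\<comment> \<open>A point of \<open>T\<close> is needed below: the first integral \<open>k\<close>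
  is seen to be nonzero by evaluating it where \<open>y\<close> does not vanish. On the empty set
  any constants serve.\<close>
proof (cases "T = {}")
  case False
  have dx: "(x has_real_derivative y t) (at t)"
    and dy: "(y has_real_derivative a (x t) * (y t)\<^sup>2 + b t * y t) (at t)"
    and dA: "(A has_real_derivative a (x t)) (at (x t))"
    and dF: "(F has_real_derivative exp (- A (x t))) (at (x t))"
    and d\<gamma>: "(\<gamma> has_real_derivative b t) (at t)"
    and dG: "(G has_real_derivative exp (\<gamma> t)) (at t)"
    if "t \<in> T" for t
    using that sol A F \<gamma> G x T(2)
    by (auto simp: solves_system_def antiderivative_on_def Xi_def)
  \<comment> \<open>The system gives \<open>y' = y * (a (x t) * y + b t)\<close>, while the
    exponential contributes the factor \<open>- a (x t) * y - b t\<close>, so the two terms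
    cancel.\<close>
  have "((\<lambda>t. y t * exp (- A (x t) - \<gamma> t)) has_real_derivative 0) (at t)" if "t \<in> T" for t
    by (rule derivative_eq_intros dy[OF that] d\<gamma>[OF that]
        DERIV_chain2[OF dA[OF that] dx[OF that]] refl)+
      (simp add: algebra_simps power2_eq_square)
  then obtain k where k: "\<And>t. t \<in> T \<Longrightarrow> y t * exp (- A (x t) - \<gamma> t) = k"
    using has_real_derivative_zero_interval_imp_constant[OF T(1)] by blast
  have yk: "y t = k * (exp (\<gamma> t) / Xi A (x t))" if "t \<in> T" for t
    using k[OF that] by (simp add: Xi_def exp_diff exp_minus field_simps)
  have "k \<noteq> 0"
    using False yk y by force
  have "((\<lambda>t. F (x t) - k * G t) has_real_derivative 0) (at t)" if "t \<in> T" for t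
    by (rule derivative_eq_intros dG[OF that] DERIV_chain2[OF dF[OF that] dx[OF that]] refl)+
      (simp add: yk[OF that] Xi_def)
  then obtain d where d: "\<And>t. t \<in> T \<Longrightarrow> F (x t) - k * G t = d"
    using has_real_derivative_zero_interval_imp_constant[OF T(1)] by blast
  \<comment> \<open>From \<open>F (x t) = d + k * G t\<close>, factoring out
    \<open>k \<noteq> 0\<close> yields \<open>c1 = - k\<close> and
    \<open>c2 = d / k\<close>.\<close>
  have "F (x t) = - (- k) * (d / k + G t) \<and> y t = - (- k) * (exp (\<gamma> t) / Xi A (x t))"
    if "t \<in> T" for t
    using d[OF that] yk[OF that] \<open>k \<noteq> 0\<close> by (simp add: distrib_left)
  then show ?thesis
    by blast
qed simp

lemma implicit_imp_solves_system:
  assumes "open I" "is_interval I"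
    and T: "open T" "T \<subseteq> J" and x: "x \<in> T \<rightarrow> I"
    and A: "antiderivative_on I a A"
    and \<gamma>: "antiderivative_on J b \<gamma>"
    and F: "antiderivative_on I (Xi A) F"
    and G: "antiderivative_on J (\<lambda>\<tau>. exp (\<gamma> \<tau>)) G"
    and eq: "\<And>t. t \<in> T \<Longrightarrow> F (x t) = - c1 * (c2 + G t)"
    and y: "\<And>t. t \<in> T \<Longrightarrow> y t = - c1 * (exp (\<gamma> t) / Xi A (x t))"
  shows "solves_system a b T x y"
  unfolding solves_system_def
proof (intro ballI conjI)
  fix t assume t: "t \<in> T"
  have dG: "(G has_real_derivative exp (\<gamma> t)) (at t)"
    and d\<gamma>: "(\<gamma> has_real_derivative b t) (at t)"
    and dA: "(A has_real_derivative a (x t)) (at (x t))"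
    using t G \<gamma> A x T(2) by (auto simp: antiderivative_on_def)
  have "((\<lambda>r. - c1 * (c2 + G r)) has_real_derivative - c1 * exp (\<gamma> t)) (at t)"
    by (rule derivative_eq_intros dG refl)+ simp
  then have "(x has_real_derivative - c1 * exp (\<gamma> t) / Xi A (x t)) (at t)"
    using F by (intro has_real_derivative_implicit[where F = F and h = "\<lambda>r. - c1 * (c2 + G r)",
          OF assms(1,2) T(1) t x _ _ eq])
      (auto simp: antiderivative_on_def Xi_def)
  then show dx: "(x has_real_derivative y t) (at t)"
    using y[OF t] by simp
  \<comment> \<open>Since \<open>1 / Xi A\<close> is \<open>exp\<close> of \<open>A\<close>,
    \<open>y\<close> becomes a single exponential up to a constant. By the chain rule its derivative
    is \<open>y\<close> times \<open>b t + a (x t) * y t\<close>, which is the required right-hand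
    side.\<close>
  have y': "y r = - c1 * exp (\<gamma> r + A (x r))" if "r \<in> T" for r
    using y[OF that] by (simp add: Xi_def exp_add exp_minus field_simps)
  have "((\<lambda>r. - c1 * exp (\<gamma> r + A (x r))) has_real_derivative
      a (x t) * (y t)\<^sup>2 + b t * y t) (at t)"
    by (rule derivative_eq_intros d\<gamma> DERIV_chain2[OF dA dx] refl)+
      (simp add: y'[OF t] algebra_simps power2_eq_square)
  then show "(y has_real_derivative a (x t) * (y t)\<^sup>2 + b t * y t) (at t)"
    by (rule has_field_derivative_transform_within_open[OF _ T(1) t]) (simp add: y')
qed

lemma solves_second_order_iff_solves_system:
  "solves_second_order a b T x \<longleftrightarrow> solves_system a b T x (deriv x)"
  by (simp add: solves_second_order_def solves_system_def)

text \<open>The system is triangular: the equation for \<open>v\<close> fixes \<open>c1\<close>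
  because \<open>k \<noteq> 0\<close>, and \<open>v \<noteq> 0\<close> then forces
  \<open>c1 \<noteq> 0\<close>, so the equation for \<open>u\<close> can be solved for
  \<open>c2\<close>.\<close>

lemma integration_constants_unique:
  fixes u v G0 k :: real
  assumes "v \<noteq> 0" "k \<noteq> 0"
  shows "\<exists>!c. case c of (c1, c2) \<Rightarrow> u = - c1 * (c2 + G0) \<and> v = - c1 * k"
proof (rule ex1I)
  show "case (- v / k, u * k / v - G0) of (c1, c2) \<Rightarrow> u = - c1 * (c2 + G0) \<and> v = - c1 * k"
    using assms by simp
next
  fix c :: "real \<times> real"
  assume "case c of (c1, c2) \<Rightarrow> u = - c1 * (c2 + G0) \<and> v = - c1 * k"
  then obtain c1 c2 where "c = (c1, c2)" "u = - c1 * (c2 + G0)" "v = - c1 * k"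
    by (cases c) auto
  moreover from this have "c1 \<noteq> 0"
    using assms(1) by auto
  ultimately show "c = (- v / k, u * k / v - G0)"
    using assms(2) by simp
qed

text \<open>The antiderivatives \<open>A\<close>, \<open>\<gamma>\<close>, \<open>F\<close> and
  \<open>G\<close> are fixed throughout, so the constants are relative to that choice. The third
  conjunct expresses that initial data determine them.\<close>

theorem proposition2p1:
  fixes I J :: "real set" and a b A \<gamma> F G :: "real \<Rightarrow> real"
  assumes "open I" and "is_interval I" and "open J" and "is_interval J"
    and "continuous_on I a" and "continuous_on J b"
    and "antiderivative_on I a A"
    and "antiderivative_on J b \<gamma>"
    and "antiderivative_on I (Xi A) F"
    and "antiderivative_on J (\<lambda>\<tau>. exp (\<gamma> \<tau>)) G"
  shows
    "(\<forall>J' x y. open J' \<and> is_interval J' \<and> J' \<subseteq> J \<and> x \<in> J' \<rightarrow> I \<and> y \<in> J' \<rightarrow> - {0} \<longrightarrow>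
        (solves_system a b J' x y \<longleftrightarrow>
          (\<exists>c1 c2. \<forall>t\<in>J'. F (x t) = - c1 * (c2 + G t) \<and>
                          y t = - c1 * (exp (\<gamma> t) / Xi A (x t)))))
   \<and> (\<forall>J' x. open J' \<and> is_interval J' \<and> J' \<subseteq> J \<and> x \<in> J' \<rightarrow> I \<and> deriv x \<in> J' \<rightarrow> - {0} \<longrightarrow>
        (solves_second_order a b J' x \<longleftrightarrow>
          (\<exists>c1 c2. \<forall>t\<in>J'. F (x t) = - c1 * (c2 + G t) \<and>
                          (x has_real_derivative - c1 * (exp (\<gamma> t) / Xi A (x t))) (at t))))
   \<and> (\<forall>t0\<in>J. \<forall>x0\<in>I. \<forall>y0. y0 \<noteq> 0 \<longrightarrow>
        (\<exists>!c. case c of (c1, c2) \<Rightarrow>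
           F x0 = - c1 * (c2 + G t0) \<and> y0 = - c1 * (exp (\<gamma> t0) / Xi A x0)))"
proof (intro conjI allI ballI impI)
  fix T and x y :: "real \<Rightarrow> real"
  assume T: "open T \<and> is_interval T \<and> T \<subseteq> J \<and> x \<in> T \<rightarrow> I \<and> y \<in> T \<rightarrow> - {0}"
  show "solves_system a b T x y \<longleftrightarrow>
    (\<exists>c1 c2. \<forall>t\<in>T. F (x t) = - c1 * (c2 + G t) \<and> y t = - c1 * (exp (\<gamma> t) / Xi A (x t)))"
  proof
    assume "solves_system a b T x y"
    then show "\<exists>c1 c2. \<forall>t\<in>T. F (x t) = - c1 * (c2 + G t) \<and>
        y t = - c1 * (exp (\<gamma> t) / Xi A (x t))"
      using T by (intro solves_system_imp_implicit[OF _ _ _ _ assms(7-10)]) simp_all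
  next
    assume "\<exists>c1 c2. \<forall>t\<in>T. F (x t) = - c1 * (c2 + G t) \<and>
      y t = - c1 * (exp (\<gamma> t) / Xi A (x t))"
    then obtain c1 c2 where "\<forall>t\<in>T. F (x t) = - c1 * (c2 + G t) \<and>
        y t = - c1 * (exp (\<gamma> t) / Xi A (x t))"
      by blast
    then show "solves_system a b T x y"
      using T by (intro implicit_imp_solves_system
          [where ?c1.0 = c1 and ?c2.0 = c2, OF assms(1,2) _ _ _ assms(7-10)]) simp_all
  qed
next
  fix T and x :: "real \<Rightarrow> real"
  assume T: "open T \<and> is_interval T \<and> T \<subseteq> J \<and> x \<in> T \<rightarrow> I \<and> deriv x \<in> T \<rightarrow> - {0}"
  show "solves_second_order a b T x \<longleftrightarrow>
    (\<exists>c1 c2. \<forall>t\<in>T. F (x t) = - c1 * (c2 + G t) \<and>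
      (x has_real_derivative - c1 * (exp (\<gamma> t) / Xi A (x t))) (at t))"
  proof
    assume "solves_second_order a b T x"
    then have sol: "solves_system a b T x (deriv x)"
      by (simp add: solves_second_order_iff_solves_system)
    then have "\<exists>c1 c2. \<forall>t\<in>T. F (x t) = - c1 * (c2 + G t) \<and>
        deriv x t = - c1 * (exp (\<gamma> t) / Xi A (x t))"
      using T by (intro solves_system_imp_implicit[OF _ _ _ _ assms(7-10)]) simp_all
    \<comment> \<open>An equation for \<open>deriv x t\<close> alone does not assert
      differentiability; the solution property provides it.\<close>
    moreover have "(x has_real_derivative deriv x t) (at t)" if "t \<in> T" for t
      using sol that by (simp add: solves_system_def)
    ultimately show "\<exists>c1 c2. \<forall>t\<in>T. F (x t) = - c1 * (c2 + G t) \<and>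
        (x has_real_derivative - c1 * (exp (\<gamma> t) / Xi A (x t))) (at t)"
      by metis
  next
    assume "\<exists>c1 c2. \<forall>t\<in>T. F (x t) = - c1 * (c2 + G t) \<and>
      (x has_real_derivative - c1 * (exp (\<gamma> t) / Xi A (x t))) (at t)"
    then obtain c1 c2 where c: "\<forall>t\<in>T. F (x t) = - c1 * (c2 + G t) \<and>
        (x has_real_derivative - c1 * (exp (\<gamma> t) / Xi A (x t))) (at t)"
      by blast
    \<comment> \<open>Uniqueness of derivatives identifies \<open>deriv x\<close> with the given
      formula, so the result for the system applies with \<open>deriv x\<close> as
      \<open>y\<close>.\<close>
    have "deriv x t = - c1 * (exp (\<gamma> t) / Xi A (x t))" if "t \<in> T" for t
      using c that by (intro DERIV_imp_deriv) blast
    then show "solves_second_order a b T x"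
      unfolding solves_second_order_iff_solves_system
      using T c by (intro implicit_imp_solves_system
          [where ?c1.0 = c1 and ?c2.0 = c2, OF assms(1,2) _ _ _ assms(7-10)]) simp_all
  qed
next
  fix t0 x0 y0 :: real
  assume "y0 \<noteq> 0"
  then show "\<exists>!c. case c of (c1, c2) \<Rightarrow>
      F x0 = - c1 * (c2 + G t0) \<and> y0 = - c1 * (exp (\<gamma> t0) / Xi A x0)"
    by (rule integration_constants_unique) (simp add: Xi_def)
qed

end
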